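(* Let $(X, \|\cdot\|)$ be a real normed space of dimension at least $2$, and let $\lambda \in [0, 1]$ with $\lambda\neq\frac{1}{2}$. The following conditions are equivalent: (i) $\perp_{\rho}\subseteq \perp_{\rho_{\lambda}}$. (ii) $\perp_{\rho_{\lambda}}\subseteq\perp_{\rho}$. (iii) $\perp_{\rho_{\lambda}} = \perp_{\rho}$. (iv) $X$ is smooth.
   Context: For a real normed space $X$ and $x,y\in X$, the norm derivatives are $\rho_{-}(x,y):=\|x\|\lim_{t\to 0^{-}}\frac{\|x+ty\|-\|x\|}{t}$ and $\rho_{+}(x,y):=\|x\|\lim_{t\to 0^{+}}\frac{\|x+ty\|-\|x\|}{t}$ (the limits exist by convexity of the norm). Put $\rho(x,y):=\frac{\rho_-(x,y)+\rho_+(x,y)}{2}$; $x\perp_{\rho}y$ means $\rho(x,y)=0$. For $\lambda\in[0,1]$, $\rho_{\lambda}(x, y) := \lambda\rho_-(x,y) + (1 - \lambda)\rho_+(x,y)$, and $x\perp_{\rho_{\lambda}}y$ means $\rho_{\lambda}(x,y)=0$. Inclusions and equalities are between relations viewed as subsets of $X\times X$. A support functional at a nonzero $x\in X$ is a norm-one linear functional $F_x$ on $X$ with $F_x(x)=\|x\|$; $X$ is smooth at $x$ if there is a unique support functional at $x$, and $X$ is smooth if it is smooth at every nonzero $x\in X$. *)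

theory Defs
  imports "HOL-Analysis.Analysis"
begin

definition rho_minus :: "'a::real_normed_vector \<Rightarrow> 'a \<Rightarrow> real" where
  "rho_minus x y = norm x * Lim (at_left 0) (\<lambda>t. (norm (x + t *\<^sub>R y) - norm x) / t)"

definition rho_plus :: "'a::real_normed_vector \<Rightarrow> 'a \<Rightarrow> real" where
  "rho_plus x y = norm x * Lim (at_right 0) (\<lambda>t. (norm (x + t *\<^sub>R y) - norm x) / t)"

definition rho :: "'a::real_normed_vector \<Rightarrow> 'a \<Rightarrow> real" where
  "rho x y = (rho_minus x y + rho_plus x y) / 2"

definition rho_lam :: "real \<Rightarrow> 'a::real_normed_vector \<Rightarrow> 'a \<Rightarrow> real" where
  "rho_lam l x y = l * rho_minus x y + (1 - l) * rho_plus x y"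

definition rho_orth :: "('a::real_normed_vector \<times> 'a) set" where
  "rho_orth = {(x, y). rho x y = 0}"

definition rho_lam_orth :: "real \<Rightarrow> ('a::real_normed_vector \<times> 'a) set" where
  "rho_lam_orth l = {(x, y). rho_lam l x y = 0}"

text \<open>A linear functional of norm one is bounded, so support functionals live in the
  dual space of bounded linear functionals, whose norm is the operator norm.\<close>

definition support_functional :: "'a::real_normed_vector \<Rightarrow> ('a \<Rightarrow>\<^sub>L real) \<Rightarrow> bool" where
  "support_functional x F \<longleftrightarrow> norm F = 1 \<and> blinfun_apply F x = norm x"

definition smooth_at :: "'a::real_normed_vector \<Rightarrow> bool" where
  "smooth_at x \<longleftrightarrow> (\<exists>!F. support_functional x F)"

definition smooth_space :: "'a::real_normed_vector itself \<Rightarrow> bool" where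
  "smooth_space _ \<longleftrightarrow> (\<forall>x::'a. x \<noteq> 0 \<longrightarrow> smooth_at x)"

text \<open>The library's \<open>dim UNIV\<close> is 0 for infinite-dimensional spaces, which must be allowed
  here; hence dimension at least n is expressed by n linearly independent vectors.\<close>

definition dim_at_least :: "nat \<Rightarrow> 'a::real_vector itself \<Rightarrow> bool" where
  "dim_at_least n _ \<longleftrightarrow> (\<exists>B::'a set. independent B \<and> finite B \<and> card B = n)"

end

theory Submission
  imports Defs
begin

text \<open>
  Write \<open>D x y\<close> (below \<open>dnorm x y\<close>) for the right derivative at \<open>0\<close> of
  \<open>t \<mapsto> \<parallel>x + t y\<parallel>\<close>. Both norm derivatives are
  expressed by it: \<open>\<rho>\<^sub>+(x,y) = \<parallel>x\<parallel> D x y\<close> and \<open>\<rho>\<^sub>-(x,y) = - \<parallel>x\<parallel> D x (-y)\<close>. Each of the four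
  conditions turns out to say that \<open>\<rho>\<^sub>- = \<rho>\<^sub>+\<close>.

  For the inclusions, note that \<open>\<rho>\<close> is \<open>\<rho>\<^sub>\<lambda>\<close> with \<open>\<lambda> = 1/2\<close>, so that both concern
  \<open>\<perp>\<^bsub>\<rho>\<^sub>a\<^esub> \<subseteq> \<perp>\<^bsub>\<rho>\<^sub>b\<^esub>\<close> for some \<open>a \<noteq> b\<close>. Every \<open>\<rho>\<^sub>\<lambda>\<close> satisfies
  \<open>\<rho>\<^sub>\<lambda>(x, y + c x) = \<rho>\<^sub>\<lambda>(x,y) + c \<parallel>x\<parallel>\<^sup>2\<close>. Hence, for \<open>x \<noteq> 0\<close>, any \<open>y\<close> can be moved along \<open>x\<close>
  to a vector that is \<open>\<rho>\<^sub>a\<close>-orthogonal to \<open>x\<close>; the inclusion makes it \<open>\<rho>\<^sub>b\<close>-orthogonal, and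
  moving back gives \<open>\<rho>\<^sub>a(x,y) = \<rho>\<^sub>b(x,y)\<close>, that is \<open>(a - b)(\<rho>\<^sub>-(x,y) - \<rho>\<^sub>+(x,y)) = 0\<close>. This is
  \<open>rho_lam_orth_subset_iff\<close>.

  For smoothness at \<open>x \<noteq> 0\<close>, the functional \<open>D x\<close> is sublinear, and the support functionals at
  \<open>x\<close> are exactly the linear functionals below it. If \<open>D x\<close> is odd, it is itself
  linear and is the only linear functional below it. Conversely, by the Hahn--Banach theorem there
  are linear functionals below \<open>D x\<close> that agree with it at \<open>y\<close> and at \<open>-y\<close> respectively; if they
  coincide, then \<open>D x (-y) = - D x y\<close>. This is \<open>smooth_at_iff_dnorm_odd\<close>.

  The Hahn--Banach theorem is derived from Zorn's lemma applied to the sublinear functionals below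
  a given one: a minimal one is linear, since \<open>sublinear_steepen\<close> would otherwise lower it.
\<close>

section \<open>Sublinear functionals and a Hahn--Banach theorem\<close>

text \<open>Homogeneity is only required as an inequality, which is easier to verify for infima;
  equality follows on replacing \<open>c\<close> by \<open>1/c\<close>, see \<open>sublinear_scale\<close>.\<close>

definition sublinear :: "('a::real_vector \<Rightarrow> real) \<Rightarrow> bool" where
  "sublinear q \<longleftrightarrow> (\<forall>v w. q (v + w) \<le> q v + q w) \<and> (\<forall>c v. 0 \<le> c \<longrightarrow> q (c *\<^sub>R v) \<le> c * q v)"

lemma sublinearI:
  assumes "\<And>v w. q (v + w) \<le> q v + q w" "\<And>c v. 0 < c \<Longrightarrow> q (c *\<^sub>R v) \<le> c * q v" "q 0 \<le> 0"
  shows "sublinear q"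
  unfolding sublinear_def using assms by (metis less_eq_real_def mult_zero_left scaleR_zero_left)

lemma sublinear_add: "sublinear q \<Longrightarrow> q (v + w) \<le> q v + q w"
  by (simp add: sublinear_def)

lemma sublinear_scale_le: "sublinear q \<Longrightarrow> 0 \<le> c \<Longrightarrow> q (c *\<^sub>R v) \<le> c * q v"
  by (simp add: sublinear_def)

lemma sublinear_zero:
  assumes "sublinear q" shows "q 0 = 0"
  using sublinear_add[OF assms, of 0 0] sublinear_scale_le[OF assms, of 0 0] by simp

lemma sublinear_scale:
  assumes "sublinear q" "0 \<le> c"
  shows "q (c *\<^sub>R v) = c * q v"
proof (cases "c = 0")
  case False
  then have "c > 0" using assms by simp
  then have "q v \<le> inverse c * q (c *\<^sub>R v)"
    using sublinear_scale_le[OF assms(1), of "inverse c" "c *\<^sub>R v"] by simp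
  then have "c * q v \<le> q (c *\<^sub>R v)"
    using \<open>c > 0\<close> by (simp add: field_simps)
  then show ?thesis using sublinear_scale_le[OF assms] by (meson antisym)
qed (simp add: sublinear_zero assms)

lemma sublinear_ge_neg:
  assumes "sublinear q" shows "- q (- v) \<le> q v"
  using sublinear_add[OF assms, of v "- v"] sublinear_zero[OF assms] by simp

lemma sublinear_odd_imp_linear:
  assumes "sublinear q" and odd: "\<And>v. q (- v) = - q v"
  shows "linear q"
proof
  fix v w
  show "q (v + w) = q v + q w"
    using sublinear_add[OF assms(1), of v w] sublinear_add[OF assms(1), of "v + w" "- w"] odd[of w]
    by simp
next
  fix c v
  show "q (c *\<^sub>R v) = c *\<^sub>R q v"
    using sublinear_scale[OF assms(1), of c v] sublinear_scale[OF assms(1), of "- c" v]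
      odd[of "c *\<^sub>R v"] by (cases "0 \<le> c") auto
qed

text \<open>The functional \<open>r v = inf\<^sub>t\<^sub>\<ge>\<^sub>0 (q (v + t y) - t q y)\<close> works: \<open>t = 0\<close> shows that it lies below
  \<open>q\<close>, and \<open>t = 1\<close> gives the value at \<open>-y\<close>. A linear functional below \<open>r\<close> is forced to be at
  least \<open>q y\<close> at \<open>y\<close>, so passing from \<open>q\<close> to \<open>r\<close> prescribes a value at \<open>y\<close>; and a minimal \<open>q\<close>,
  being equal to \<open>r\<close>, is odd at \<open>y\<close>.\<close>

lemma sublinear_steepen:
  assumes q: "sublinear q"
  obtains r where "sublinear r" "\<And>v. r v \<le> q v" "r (- y) \<le> - q y"
proof -
  define g where "g v t = q (v + t *\<^sub>R y) - t * q y" for v t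
  define r where "r v = (INF t\<in>{0..}. g v t)" for v
  have bdd: "bdd_below (g v ` {0..})" for v
  proof (rule bdd_belowI2)
    fix t :: real assume t: "t \<in> {0..}"
    show "- q (- v) \<le> g v t"
      using sublinear_add[OF q, of "v + t *\<^sub>R y" "- v"] sublinear_scale[OF q, of t y] t
      by (simp add: g_def)
  qed
  have le: "r v \<le> g v t" if "0 \<le> t" for v t
    unfolding r_def using that by (intro cINF_lower bdd) auto
  have ge: "m \<le> r v" if "\<And>t. 0 \<le> t \<Longrightarrow> m \<le> g v t" for m v
    unfolding r_def using that by (intro cINF_greatest) auto
  show thesis
  proof
    show "r v \<le> q v" for v using le[of 0 v] by (simp add: g_def)
    show "r (- y) \<le> - q y" using le[of 1 "- y"] by (simp add: g_def sublinear_zero[OF q])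
    show "sublinear r"
    proof (rule sublinearI)
      fix v w
      have "r (v + w) \<le> g v s + g w t" if "0 \<le> s" "0 \<le> t" for s t
        using le[of "s + t" "v + w"] that sublinear_add[OF q, of "v + s *\<^sub>R y" "w + t *\<^sub>R y"]
        by (simp add: g_def algebra_simps)
      then have "r (v + w) - g v s \<le> r w" if "0 \<le> s" for s
        using that by (intro ge) (simp add: algebra_simps)
      then have "r (v + w) - r w \<le> r v" by (intro ge) (simp add: algebra_simps)
      then show "r (v + w) \<le> r v + r w" by simp
    next
      fix c :: real and v assume c: "0 < c"
      have "r (c *\<^sub>R v) \<le> c * g v t" if "0 \<le> t" for t
        using le[of "c * t" "c *\<^sub>R v"] that c sublinear_scale[OF q, of c "v + t *\<^sub>R y"]
        by (simp add: g_def algebra_simps)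
      then have "r (c *\<^sub>R v) / c \<le> r v"
        using c by (intro ge) (simp add: field_simps)
      then show "r (c *\<^sub>R v) \<le> c * r v" using c by (simp add: field_simps)
    next
      show "r 0 \<le> 0" using le[of 0 0] by (simp add: g_def sublinear_zero[OF q])
    qed
  qed
qed

text \<open>The pointwise infimum exists because \<open>q v \<ge> - q (-v) \<ge> - p (-v)\<close> for every member \<open>q\<close>. Infima
  of sublinear functionals are not subadditive in general; along a chain they are, because two
  members used for the two summands can be replaced by the smaller one.\<close>

lemma sublinear_chain_Inf:
  assumes ne: "C \<noteq> {}" and sub: "\<And>q. q \<in> C \<Longrightarrow> sublinear q \<and> q \<le> p"
    and chain: "\<And>q r. q \<in> C \<Longrightarrow> r \<in> C \<Longrightarrow> q \<le> r \<or> r \<le> q"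
  obtains u where "sublinear u" "u \<le> p" "\<And>q. q \<in> C \<Longrightarrow> u \<le> q"
proof -
  define u where "u v = (INF q\<in>C. q v)" for v
  have bdd: "bdd_below ((\<lambda>q. q v) ` C)" for v
  proof (rule bdd_belowI2)
    fix q assume "q \<in> C"
    then show "- p (- v) \<le> q v"
      using sub[of q] sublinear_ge_neg[of q v] by (simp add: le_fun_def) (smt (verit))
  qed
  have le: "u v \<le> q v" if "q \<in> C" for v q
    unfolding u_def using that by (intro cINF_lower bdd) auto
  have ge: "m \<le> u v" if "\<And>q. q \<in> C \<Longrightarrow> m \<le> q v" for m v
    unfolding u_def using that ne by (intro cINF_greatest) auto
  show thesis
  proof
    show "u \<le> q" if "q \<in> C" for q using le[OF that] by (simp add: le_fun_def)
    with ne sub show "u \<le> p" by (meson equals0I order_trans)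
    show "sublinear u"
    proof (rule sublinearI)
      fix v w
      have "u (v + w) \<le> q v + r w" if qr: "q \<in> C" "r \<in> C" for q r
      proof -
        obtain m where "m \<in> C" "m \<le> q" "m \<le> r"
          using chain[OF qr] qr by blast
        then show ?thesis
          using le[of m "v + w"] sub[of m] sublinear_add[of m v w]
          by (smt (verit) le_funD)
      qed
      then have "u (v + w) - q v \<le> r w" if "q \<in> C" "r \<in> C" for q r
        using that by (metis add.commute diff_le_eq)
      then have "u (v + w) - q v \<le> u w" if "q \<in> C" for q
        using that by (intro ge)
      then have "u (v + w) - u w \<le> u v" by (intro ge) (simp add: algebra_simps)
      then show "u (v + w) \<le> u v + u w" by simp
    next
      fix c :: real and v assume c: "0 < c"
      have "u (c *\<^sub>R v) \<le> c * q v" if "q \<in> C" for q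
        using le[OF that, of "c *\<^sub>R v"] sublinear_scale_le[of q c v] sub[OF that] c by simp
      then have "u (c *\<^sub>R v) / c \<le> u v"
        using c by (intro ge) (simp add: field_simps)
      then show "u (c *\<^sub>R v) \<le> c * u v" using c by (simp add: field_simps)
    next
      obtain q where "q \<in> C" using ne by blast
      then show "u 0 \<le> 0" using le[of q 0] sub[of q] sublinear_zero[of q] by simp
    qed
  qed
qed

lemma ex_linear_le_sublinear:
  fixes p :: "'a::real_vector \<Rightarrow> real"
  assumes p: "sublinear p"
  obtains f where "linear f" "\<And>v. f v \<le> p v"
proof -
  define A where "A = {q::'a \<Rightarrow> real. sublinear q \<and> q \<le> p}"
  have "\<exists>m\<in>A. \<forall>q\<in>A. q \<le> m \<longrightarrow> q = m"
  proof (rule predicate_Zorn)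
    show "partial_order_on A (relation_of (\<lambda>q r. r \<le> q) A)"
      by (rule partial_order_on_relation_ofI) auto
  next
    fix C assume "C \<in> Chains (relation_of (\<lambda>q r. r \<le> q) A)"
    then have CA: "C \<subseteq> A" and chain: "\<And>q r. q \<in> C \<Longrightarrow> r \<in> C \<Longrightarrow> q \<le> r \<or> r \<le> q"
      unfolding Chains_def relation_of_def by blast+
    show "\<exists>u\<in>A. \<forall>q\<in>C. u \<le> q"
    proof (cases "C = {}")
      case True
      with p show ?thesis by (auto simp: A_def)
    next
      case False
      then obtain u where "sublinear u" "u \<le> p" "\<And>q. q \<in> C \<Longrightarrow> u \<le> q"
        using sublinear_chain_Inf[of C p] CA chain unfolding A_def by blast
      then show ?thesis by (auto simp: A_def)
    qed
  qed
  then obtain m where m: "sublinear m" "m \<le> p"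
    and min: "\<And>q. sublinear q \<Longrightarrow> q \<le> p \<Longrightarrow> q \<le> m \<Longrightarrow> q = m"
    by (auto simp: A_def)
  have "m (- y) = - m y" for y
  proof -
    obtain r where r: "sublinear r" "\<And>v. r v \<le> m v" "r (- y) \<le> - m y"
      using sublinear_steepen[OF m(1)] by blast
    then have "r = m" using min m(2) by (meson le_funI order_trans)
    with r(3) sublinear_ge_neg[OF m(1), of y] show ?thesis by simp
  qed
  then have "linear m" by (rule sublinear_odd_imp_linear[OF m(1)])
  with m(2) that show thesis by (simp add: le_fun_def)
qed

theorem Hahn_Banach_sublinear:
  assumes "sublinear p"
  obtains f where "linear f" "\<And>v. f v \<le> p v" "f y = p y"
proof -
  obtain r where r: "sublinear r" "\<And>v. r v \<le> p v" "r (- y) \<le> - p y"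
    using sublinear_steepen[OF assms] by blast
  obtain f where f: "linear f" "\<And>v. f v \<le> r v"
    using ex_linear_le_sublinear[OF r(1)] by blast
  have le: "f v \<le> p v" for v using f(2) r(2) by (meson order_trans)
  moreover have "f y = p y"
    using f(2)[of "- y"] r(3) linear_neg[OF f(1), of y] le[of y] by simp
  ultimately show thesis using that f(1) by blast
qed

section \<open>The one-sided derivative of the norm\<close>

text \<open>Unlike \<^const>\<open>rho_plus\<close>, this is not multiplied by \<open>\<parallel>x\<parallel>\<close>, so that a support functional at
  \<open>x\<close> can be compared with it directly.\<close>

definition dnorm :: "'a::real_normed_vector \<Rightarrow> 'a \<Rightarrow> real" where
  "dnorm x y = Lim (at_right 0) (\<lambda>t. (norm (x + t *\<^sub>R y) - norm x) / t)"

text \<open>Difference quotients of a convex function increase: \<open>x + s y\<close> is the convex combination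
  of \<open>x\<close> and \<open>x + t y\<close> with weights \<open>1 - s/t\<close> and \<open>s/t\<close>.\<close>

lemma norm_quotient_mono:
  fixes x y :: "'a::real_normed_vector"
  assumes "0 < s" "s \<le> t"
  shows "(norm (x + s *\<^sub>R y) - norm x) / s \<le> (norm (x + t *\<^sub>R y) - norm x) / t"
proof -
  have "t *\<^sub>R (x + s *\<^sub>R y) = (t - s) *\<^sub>R x + s *\<^sub>R (x + t *\<^sub>R y)"
    by (simp add: algebra_simps)
  then have "t * norm (x + s *\<^sub>R y) = norm ((t - s) *\<^sub>R x + s *\<^sub>R (x + t *\<^sub>R y))"
    using assms by (metis abs_of_pos dual_order.strict_trans1 norm_scaleR)
  also have "\<dots> \<le> (t - s) * norm x + s * norm (x + t *\<^sub>R y)"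
    using norm_triangle_ineq[of "(t - s) *\<^sub>R x" "s *\<^sub>R (x + t *\<^sub>R y)"] assms by simp
  finally show ?thesis using assms by (simp add: field_simps)
qed

text \<open>The quotient decreases as \<open>t\<close> decreases to \<open>0\<close> and stays above \<open>- \<parallel>y\<parallel>\<close>, so it converges to
  its infimum over \<open>t > 0\<close>.\<close>

lemma
  fixes x y :: "'a::real_normed_vector"
  shows dnorm_tendsto:
      "((\<lambda>t. (norm (x + t *\<^sub>R y) - norm x) / t) \<longlongrightarrow> dnorm x y) (at_right 0)"
    and dnorm_le_quotient: "0 < t \<Longrightarrow> dnorm x y \<le> (norm (x + t *\<^sub>R y) - norm x) / t"
proof -
  let ?q = "\<lambda>t. (norm (x + t *\<^sub>R y) - norm x) / t"
  have lower: "- norm y \<le> ?q t" if "0 < t" for t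
  proof -
    have "norm x \<le> norm (x + t *\<^sub>R y) + t * norm y"
      using norm_triangle_ineq4[of "x + t *\<^sub>R y" "t *\<^sub>R y"] that by simp
    then show ?thesis using that by (simp add: field_simps)
  qed
  have "(?q \<longlongrightarrow> Inf (?q ` ({0<..} \<inter> UNIV))) (at 0 within ({0<..} \<inter> UNIV))"
    by (rule Lim_right_bound[where K = "- norm y"]) (use norm_quotient_mono lower in auto)
  then have lim: "(?q \<longlongrightarrow> Inf (?q ` {0<..})) (at_right 0)" by simp
  then have eq: "dnorm x y = Inf (?q ` {0<..})"
    unfolding dnorm_def by (intro tendsto_Lim) auto
  show "(?q \<longlongrightarrow> dnorm x y) (at_right 0)" using lim eq by simp
  show "dnorm x y \<le> ?q t" if "0 < t"
    unfolding eq by (intro cINF_lower bdd_belowI2[where m = "- norm y"]) (use lower that in auto)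
qed

lemma le_dnorm:
  assumes "\<And>t. 0 < t \<Longrightarrow> m \<le> (norm (x + t *\<^sub>R y) - norm x) / t"
  shows "m \<le> dnorm x y"
  by (rule tendsto_lowerbound[OF dnorm_tendsto])
     (use assms in \<open>auto simp: eventually_at_filter\<close>)

lemma dnorm_le_norm: "dnorm x y \<le> norm y"
  using dnorm_le_quotient[of 1 x y] norm_triangle_ineq[of x y] by simp

text \<open>Subadditivity is the midpoint inequality for the norm at \<open>x + m u\<close> and \<open>x + m v\<close>: it bounds
  the quotient of \<open>u + v\<close> at \<open>m/2\<close> by the quotients of \<open>u\<close> and \<open>v\<close> at \<open>m\<close>.\<close>

lemma sublinear_dnorm: "sublinear (dnorm x)"
proof (rule sublinearI)
  fix u v
  let ?q = "\<lambda>y t. (norm (x + t *\<^sub>R y) - norm x) / t"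
  have "dnorm x (u + v) \<le> ?q u s + ?q v t" if st: "0 < s" "0 < t" for s t
  proof -
    define m where "m = min s t"
    have m: "0 < m" "m \<le> s" "m \<le> t" using st by (auto simp: m_def)
    have "x + (m / 2) *\<^sub>R (u + v) = (1/2) *\<^sub>R ((x + m *\<^sub>R u) + (x + m *\<^sub>R v))"
      by (simp add: algebra_simps flip: scaleR_add_left)
    then have "norm (x + (m / 2) *\<^sub>R (u + v)) \<le> (norm (x + m *\<^sub>R u) + norm (x + m *\<^sub>R v)) / 2"
      using norm_triangle_ineq[of "x + m *\<^sub>R u" "x + m *\<^sub>R v"] by simp
    then have "2 * (norm (x + (m / 2) *\<^sub>R (u + v)) - norm x) / m
        \<le> ((norm (x + m *\<^sub>R u) - norm x) + (norm (x + m *\<^sub>R v) - norm x)) / m"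
      using m by (intro divide_right_mono) (auto simp del: scaleR_add_right)
    then have "?q (u + v) (m / 2) \<le> ?q u m + ?q v m"
      by (simp only: add_divide_distrib divide_divide_eq_right mult.commute)
    also have "\<dots> \<le> ?q u s + ?q v t"
      using m by (intro add_mono norm_quotient_mono)
    finally show ?thesis using dnorm_le_quotient[of "m / 2" x "u + v"] m by simp
  qed
  then have "dnorm x (u + v) - ?q u s \<le> ?q v t" if "0 < s" "0 < t" for s t
    using that by (metis add.commute diff_le_eq)
  then have "dnorm x (u + v) - ?q u s \<le> dnorm x v" if "0 < s" for s
    using that by (intro le_dnorm)
  then have "dnorm x (u + v) - dnorm x v \<le> dnorm x u" by (intro le_dnorm) (simp add: algebra_simps)
  then show "dnorm x (u + v) \<le> dnorm x u + dnorm x v" by simp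
next
  fix c :: real and y assume c: "0 < c"
  have "dnorm x (c *\<^sub>R y) / c \<le> (norm (x + t *\<^sub>R y) - norm x) / t" if "0 < t" for t
    using dnorm_le_quotient[of "t / c" x "c *\<^sub>R y"] c that by (simp add: field_simps)
  then have "dnorm x (c *\<^sub>R y) / c \<le> dnorm x y" by (rule le_dnorm)
  then show "dnorm x (c *\<^sub>R y) \<le> c * dnorm x y" using c by (simp add: field_simps)
next
  show "dnorm x 0 \<le> 0" using dnorm_le_norm[of x 0] by simp
qed

lemma dnorm_self: "dnorm x x = norm x"
proof (rule antisym)
  show "dnorm x x \<le> norm x" by (rule dnorm_le_norm)
  show "norm x \<le> dnorm x x"
  proof (rule le_dnorm)
    fix t :: real assume t: "0 < t"
    have "norm (x + t *\<^sub>R x) = (1 + t) * norm x"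
      using t by (metis abs_of_pos add_pos_pos norm_scaleR scaleR_add_left scaleR_one zero_less_one)
    then show "norm x \<le> (norm (x + t *\<^sub>R x) - norm x) / t" using t by (simp add: field_simps)
  qed
qed

lemma dnorm_minus_self: "dnorm x (- x) = - norm x"
  using dnorm_le_quotient[of 1 x "- x"] sublinear_ge_neg[OF sublinear_dnorm, of x x] dnorm_self[of x]
  by simp

lemma dnorm_scale_self: "dnorm x (c *\<^sub>R x) = c * norm x"
  using sublinear_scale[OF sublinear_dnorm, of c x x]
    sublinear_scale[OF sublinear_dnorm, of "- c" x "- x"]
  by (cases "0 \<le> c") (simp_all add: dnorm_self dnorm_minus_self)

text \<open>On multiples of \<open>x\<close> the functional is linear, so subadditivity applied to \<open>y + c x\<close> and to
  \<open>y = (y + c x) - c x\<close> gives both inequalities.\<close>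

lemma dnorm_shift: "dnorm x (y + c *\<^sub>R x) = dnorm x y + c * norm x"
  using sublinear_add[OF sublinear_dnorm, of x y "c *\<^sub>R x"]
    sublinear_add[OF sublinear_dnorm, of x "y + c *\<^sub>R x" "(- c) *\<^sub>R x"]
    dnorm_scale_self[of x c] dnorm_scale_self[of x "- c"]
  by simp

section \<open>Smoothness and the norm derivatives\<close>

lemma support_functional_le_dnorm:
  assumes "support_functional x F"
  shows "blinfun_apply F y \<le> dnorm x y"
proof (rule le_dnorm)
  fix t :: real assume t: "0 < t"
  have "blinfun_apply F (x + t *\<^sub>R y) \<le> norm (x + t *\<^sub>R y)"
    using norm_blinfun[of F "x + t *\<^sub>R y"] assms by (simp add: support_functional_def)
  then show "blinfun_apply F y \<le> (norm (x + t *\<^sub>R y) - norm x) / t"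
    using t assms by (simp add: support_functional_def blinfun.bilinear_simps field_simps)
qed

text \<open>The bound \<open>D x v \<le> \<parallel>v\<parallel>\<close> gives \<open>f\<close> norm at most one, and \<open>D x (\<plusminus>x) = \<plusminus>\<parallel>x\<parallel>\<close> leaves only the
  value \<open>\<parallel>x\<parallel>\<close> for \<open>f x\<close>.\<close>

lemma linear_le_dnorm_support_functional:
  assumes x: "x \<noteq> 0" and f: "linear f" "\<And>v. f v \<le> dnorm x v"
  obtains F where "support_functional x F" "blinfun_apply F = f"
proof -
  have bound: "\<bar>f v\<bar> \<le> norm v" for v
    using f(2)[of v] f(2)[of "- v"] dnorm_le_norm[of x v] dnorm_le_norm[of x "- v"]
      linear_neg[OF f(1), of v] by simp
  have "bounded_linear f"
    using f(1) bound
    by (intro bounded_linear.intro bounded_linear_axioms.intro exI[of _ 1]) auto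
  then have F: "blinfun_apply (Blinfun f) = f" by (rule bounded_linear_Blinfun_apply)
  have fx: "f x = norm x"
    using f(2)[of x] f(2)[of "- x"] linear_neg[OF f(1), of x] dnorm_self[of x] dnorm_minus_self[of x]
    by simp
  have "norm (Blinfun f) = 1"
  proof (rule antisym)
    show "norm (Blinfun f) \<le> 1" by (rule norm_blinfun_bound) (use bound F in auto)
    show "1 \<le> norm (Blinfun f)"
      using norm_blinfun[of "Blinfun f" x] x by (simp add: F fx)
  qed
  with that F fx show thesis by (simp add: support_functional_def)
qed

text \<open>The values at \<open>y\<close> of support functionals at \<open>x\<close> lie between \<open>- D x (-y)\<close> and \<open>D x y\<close>, and
  by Hahn--Banach both ends are attained. So uniqueness means that the two ends agree for
  every \<open>y\<close>; in that case \<open>D x\<close> is linear and is itself the support functional.\<close>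

lemma smooth_at_iff_dnorm_odd:
  fixes x :: "'a::real_normed_vector"
  assumes x: "x \<noteq> 0"
  shows "smooth_at x \<longleftrightarrow> (\<forall>y. dnorm x (- y) = - dnorm x y)"
proof
  assume smooth: "smooth_at x"
  show "\<forall>y. dnorm x (- y) = - dnorm x y"
  proof
    fix y
    have attain: "\<exists>F. support_functional x F \<and> blinfun_apply F z = dnorm x z" for z
      by (metis Hahn_Banach_sublinear[OF sublinear_dnorm]
          linear_le_dnorm_support_functional[OF x])
    obtain F where "support_functional x F" "blinfun_apply F y = dnorm x y"
      using attain by blast
    moreover obtain G where "support_functional x G" "blinfun_apply G (- y) = dnorm x (- y)"
      using attain by blast
    moreover have "F = G" using smooth calculation unfolding smooth_at_def by blast
    ultimately show "dnorm x (- y) = - dnorm x y" by (simp add: blinfun.bilinear_simps)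
  qed
next
  assume odd: "\<forall>y. dnorm x (- y) = - dnorm x y"
  then have "linear (dnorm x)" using sublinear_odd_imp_linear[OF sublinear_dnorm] by blast
  then obtain F where F: "support_functional x F" "blinfun_apply F = dnorm x"
    using linear_le_dnorm_support_functional[OF x] by blast
  have "G = F" if G: "support_functional x G" for G
  proof (rule blinfun_eqI)
    fix y
    show "blinfun_apply G y = blinfun_apply F y"
      using support_functional_le_dnorm[OF G, of y] support_functional_le_dnorm[OF G, of "- y"] odd F(2)
      by (simp add: blinfun.bilinear_simps)
  qed
  with F(1) show "smooth_at x" unfolding smooth_at_def by blast
qed

lemma rho_plus_dnorm: "rho_plus x y = norm x * dnorm x y"
  by (simp add: rho_plus_def dnorm_def)

lemma rho_minus_dnorm: "rho_minus x y = - (norm x * dnorm x (- y))"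
proof -
  have "((\<lambda>t. - ((norm (x + t *\<^sub>R (- y)) - norm x) / t)) \<longlongrightarrow> - dnorm x (- y)) (at_right 0)"
    by (intro tendsto_minus dnorm_tendsto)
  then have "((\<lambda>t. (norm (x + t *\<^sub>R y) - norm x) / t) \<longlongrightarrow> - dnorm x (- y)) (at_left 0)"
    by (simp add: filterlim_at_left_to_right)
  then have "Lim (at_left 0) (\<lambda>t. (norm (x + t *\<^sub>R y) - norm x) / t) = - dnorm x (- y)"
    by (intro tendsto_Lim) auto
  then show ?thesis by (simp add: rho_minus_def)
qed

lemma smooth_space_iff_rho_minus_eq_rho_plus:
  "smooth_space TYPE('a::real_normed_vector) \<longleftrightarrow> (\<forall>x y::'a. rho_minus x y = rho_plus x y)"
proof -
  have "smooth_at x \<longleftrightarrow> (\<forall>y. rho_minus x y = rho_plus x y)" if "x \<noteq> 0" for x :: 'a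
    using that by (simp add: smooth_at_iff_dnorm_odd rho_minus_dnorm rho_plus_dnorm minus_equation_iff)
      (metis mult_minus_right mult_left_cancel norm_eq_zero add.inverse_inverse)
  moreover have "rho_minus 0 y = rho_plus 0 y" for y :: 'a
    by (simp add: rho_minus_def rho_plus_def)
  ultimately show ?thesis unfolding smooth_space_def by metis
qed

section \<open>Comparing the orthogonality relations\<close>

lemma rho_lam_shift: "rho_lam l x (y + c *\<^sub>R x) = rho_lam l x y + c * (norm x)\<^sup>2"
proof -
  have shift_neg: "dnorm x (- (y + c *\<^sub>R x)) = dnorm x (- y) - c * norm x"
    using dnorm_shift[of x "- y" "- c"] by simp
  then show ?thesis
    unfolding rho_lam_def rho_minus_dnorm rho_plus_dnorm dnorm_shift shift_neg
    by (simp add: power2_eq_square algebra_simps)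
qed

text \<open>The inclusion is tested on \<open>(x, y + c x)\<close>, where \<open>c\<close> makes \<open>\<rho>\<^sub>a\<close> vanish. By the shift rule
  \<open>\<rho>\<^sub>a\<close> and \<open>\<rho>\<^sub>b\<close> then agree at \<open>(x, y)\<close> as well, and two different weights can only give the
  same combination of two numbers if the numbers are equal.\<close>

lemma rho_lam_orth_subset_iff:
  assumes "a \<noteq> b"
  shows "(rho_lam_orth a :: ('a::real_normed_vector \<times> 'a) set) \<subseteq> rho_lam_orth b \<longleftrightarrow>
    (\<forall>x y::'a. rho_minus x y = rho_plus x y)"
proof
  assume sub: "(rho_lam_orth a :: ('a \<times> 'a) set) \<subseteq> rho_lam_orth b"
  show "\<forall>x y::'a. rho_minus x y = rho_plus x y"
  proof (intro allI)
    fix x y :: 'a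
    show "rho_minus x y = rho_plus x y"
    proof (cases "x = 0")
      case True
      then show ?thesis by (simp add: rho_minus_def rho_plus_def)
    next
      case False
      define c where "c = - rho_lam a x y / (norm x)\<^sup>2"
      have "rho_lam a x (y + c *\<^sub>R x) = 0"
        using False unfolding rho_lam_shift c_def by simp
      then have "rho_lam b x (y + c *\<^sub>R x) = 0"
        using sub by (auto simp: rho_lam_orth_def)
      with \<open>rho_lam a x (y + c *\<^sub>R x) = 0\<close> have "rho_lam a x y = rho_lam b x y"
        by (simp add: rho_lam_shift)
      then have "(a - b) * (rho_minus x y - rho_plus x y) = 0"
        by (simp add: rho_lam_def algebra_simps)
      with assms show ?thesis by simp
    qed
  qed
next
  assume "\<forall>x y::'a. rho_minus x y = rho_plus x y"
  then have "rho_lam a x y = rho_lam b x y" for x y :: 'a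
    by (simp add: rho_lam_def algebra_simps)
  then show "(rho_lam_orth a :: ('a \<times> 'a) set) \<subseteq> rho_lam_orth b"
    by (simp add: rho_lam_orth_def)
qed

lemma rho_orth_eq_rho_lam_orth: "rho_orth = rho_lam_orth (1 / 2)"
  by (simp add: rho_orth_def rho_lam_orth_def rho_def rho_lam_def field_simps)

theorem theorem2p11:
  fixes l :: real
  assumes "dim_at_least 2 TYPE('a::real_normed_vector)"
    and "0 \<le> l" and "l \<le> 1" and "l \<noteq> 1 / 2"
  shows "((rho_orth :: ('a \<times> 'a) set) \<subseteq> rho_lam_orth l
            \<longleftrightarrow> (rho_lam_orth l :: ('a \<times> 'a) set) \<subseteq> rho_orth)
       \<and> ((rho_lam_orth l :: ('a \<times> 'a) set) \<subseteq> rho_orth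
            \<longleftrightarrow> (rho_lam_orth l :: ('a \<times> 'a) set) = rho_orth)
       \<and> ((rho_lam_orth l :: ('a \<times> 'a) set) = rho_orth
            \<longleftrightarrow> smooth_space TYPE('a))"
proof -
  have "(rho_orth :: ('a \<times> 'a) set) \<subseteq> rho_lam_orth l \<longleftrightarrow> smooth_space TYPE('a)"
    and "(rho_lam_orth l :: ('a \<times> 'a) set) \<subseteq> rho_orth \<longleftrightarrow> smooth_space TYPE('a)"
    using assms(4)
    by (simp_all add: rho_orth_eq_rho_lam_orth rho_lam_orth_subset_iff
        smooth_space_iff_rho_minus_eq_rho_plus)
  then show ?thesis by blast
qed

end
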